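(* Let $\mathcal H$ be a complex Hilbert space, let $k$ be a positive integer with $k<\dim\mathcal H$, and let $\mathbf A=(A_1,\dots,A_m)$ be an $m$-tuple of bounded operators on $\mathcal H$. Fix an orthogonal decomposition of $\mathcal H$ into a $k$-dimensional subspace (identified with $\mathbb C^k$) and its orthogonal complement, and write operators on $\mathcal H$ as $2\times2$ operator matrices accordingly. Suppose that either (1) $\mathcal S$ is the set of bounded operators on $\mathcal H$ of the form $aI+\begin{pmatrix}0_k&R_1\\R_2&0\end{pmatrix}$ with $a\in\mathbb C$, or (2) $\dim\mathcal H\ge2k$ and $\mathcal S$ is the set of bounded operators on $\mathcal H$ of the form $R\oplus\alpha I$ with $R$ a $k\times k$ complex matrix and $\alpha\in\mathbb C$. If there is a unitary operator $U$ on $\mathcal H$ such that $U^*A_jU\in\mathcal S$ for $j=1,\dots,m$, then $W_k(\mathbf A)$ is convex.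
   Context: For an $m$-tuple $\mathbf A=(A_1,\dots,A_m)$ of bounded operators on $\mathcal H$ and a positive integer $k\le\dim\mathcal H$, the joint $k$-numerical range is $$W_k(\mathbf A)=\Big\{\Big(\sum_{\ell=1}^k\langle A_1x_\ell,x_\ell\rangle,\dots,\sum_{\ell=1}^k\langle A_mx_\ell,x_\ell\rangle\Big):\{x_1,\dots,x_k\}\subseteq\mathcal H\text{ orthonormal}\Big\}\subseteq\mathbb C^m.$$ $0_k$ is the $k\times k$ zero matrix, $0$ the zero operator on the orthogonal complement, and $I$ the identity operator on the relevant space. *)

theory Defs
  imports "HOL-Analysis.Analysis" "HOL-Library.Extended_Nat"
begin

section \<open>Complex Hilbert spaces\<close>

text \<open>
  A complex Hilbert space is presented through its underlying real inner product space: the real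
  inner product is the real part of the complex one, so that norm, topology and completeness are
  the library's. The complex inner product is linear in the first argument.
\<close>

class complex_inner = real_inner +
  fixes scaleC :: "complex \<Rightarrow> 'a \<Rightarrow> 'a" (infixr \<open>*\<^sub>C\<close> 75)
    and cinner :: "'a \<Rightarrow> 'a \<Rightarrow> complex"
  assumes scaleC_add_right: "a *\<^sub>C (x + y) = a *\<^sub>C x + a *\<^sub>C y"
    and scaleC_add_left: "(a + b) *\<^sub>C x = a *\<^sub>C x + b *\<^sub>C x"
    and scaleC_scaleC: "a *\<^sub>C (b *\<^sub>C x) = (a * b) *\<^sub>C x"
    and scaleR_scaleC: "r *\<^sub>R x = complex_of_real r *\<^sub>C x"
    and cinner_commute: "cinner x y = cnj (cinner y x)"
    and cinner_add_left: "cinner (x + y) z = cinner x z + cinner y z"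
    and cinner_scaleC_left: "cinner (a *\<^sub>C x) y = a * cinner x y"
    and inner_eq_Re_cinner: "inner x y = Re (cinner x y)"

class complex_hilbert_space = complex_inner + complete_space

lemma scaleC_one: "1 *\<^sub>C x = (x :: 'a::complex_inner)"
  using scaleR_scaleC[of 1 x] by simp

interpretation complex_space: vector_space "scaleC :: complex \<Rightarrow> 'a::complex_inner \<Rightarrow> 'a"
  by unfold_locales (simp_all add: scaleC_add_right scaleC_add_left scaleC_scaleC scaleC_one)

text \<open>
  The dimension with all infinite cardinals collapsed to \<open>\<infinity>\<close>; it is only ever compared with
  natural numbers, and below \<open>\<infinity>\<close> the algebraic and the Hilbert space dimension agree.
\<close>

definition hilbert_dim :: "'a::complex_hilbert_space itself \<Rightarrow> enat" where
  "hilbert_dim _ =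
     (if \<exists>B :: 'a set. finite B \<and> complex_space.span B = UNIV
      then enat (complex_space.dim (UNIV :: 'a set)) else \<infinity>)"

section \<open>Bounded operators, adjoints and unitaries\<close>

definition bounded_operator :: "('a::complex_inner \<Rightarrow> 'a) \<Rightarrow> bool" where
  "bounded_operator T \<longleftrightarrow> bounded_linear T \<and> (\<forall>c x. T (c *\<^sub>C x) = c *\<^sub>C T x)"

definition adj :: "('a::complex_hilbert_space \<Rightarrow> 'a) \<Rightarrow> 'a \<Rightarrow> 'a" where
  "adj T = (THE G. \<forall>x y. cinner (T x) y = cinner x (G y))"

definition unitary :: "('a::complex_hilbert_space \<Rightarrow> 'a) \<Rightarrow> bool" where
  "unitary U \<longleftrightarrow> bounded_operator U \<and> adj U \<circ> U = id \<and> U \<circ> adj U = id"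

text \<open>Riesz representation shows that the description in \<open>adj\<close> is a proper one.\<close>

lemma real_riesz:
  fixes f :: "'a::{real_inner, complete_space} \<Rightarrow> real"
  assumes "bounded_linear f"
  obtains g where "\<And>x. f x = inner x g"
proof -
  interpret f: bounded_linear f by fact
  define J where "J x = (norm x)\<^sup>2 - 2 * f x" for x
  obtain K where K: "\<And>x. norm (f x) \<le> norm x * K"
    using f.bounded by blast
  have J_lower: "J x \<ge> - (K\<^sup>2)" for x
  proof -
    have "f x \<le> norm x * K" using K[of x] by simp
    moreover have "0 \<le> (norm x - K)\<^sup>2" by simp
    ultimately show ?thesis unfolding J_def by (simp add: power2_diff)
  qed
  define m where "m = Inf (range J)"
  have bdd: "bdd_below (range J)"
    using J_lower by (intro bdd_belowI[of _ "- (K\<^sup>2)"]) auto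
  have m_le: "m \<le> J x" for x
    unfolding m_def using bdd by (intro cInf_lower) auto
  have "\<exists>x. J x < m + inverse (real (Suc n))" for n
  proof -
    have "Inf (range J) < m + inverse (real (Suc n))" by (simp add: m_def)
    then show ?thesis using cInf_lessD[of "range J"] by blast
  qed
  then obtain u where u: "\<And>n. J (u n) < m + inverse (real (Suc n))" by metis
  have par: "(norm (x - y))\<^sup>2 \<le> 2 * (J x + J y - 2 * m)" for x y
  proof -
    have "(norm (x - y))\<^sup>2 = 2 * (J x + J y - 2 * J ((1/2) *\<^sub>R (x + y)))"
      unfolding J_def power2_norm_eq_inner
      by (simp add: f.scaleR f.add inner_simps inner_commute field_simps)
    then show ?thesis using m_le[of "(1/2) *\<^sub>R (x + y)"] by simp
  qed
  have "Cauchy u"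
  proof (rule CauchyI)
    fix e :: real assume "e > 0"
    obtain N where N: "inverse (real (Suc N)) < e\<^sup>2 / 4"
      using reals_Archimedean[of "e\<^sup>2 / 4"] \<open>e > 0\<close> by auto
    have "norm (u p - u q) < e" if "p \<ge> N" "q \<ge> N" for p q
    proof -
      have "inverse (real (Suc p)) \<le> inverse (real (Suc N))"
           "inverse (real (Suc q)) \<le> inverse (real (Suc N))"
        using that by (auto intro!: le_imp_inverse_le)
      then have "J (u p) + J (u q) - 2 * m < e\<^sup>2 / 2" using u[of p] u[of q] N by linarith
      then have "(norm (u p - u q))\<^sup>2 < e\<^sup>2" 
        using par[of "u p" "u q"] by (simp add: field_simps)
      then show ?thesis using \<open>e > 0\<close> by (simp add: power2_less_imp_less)
    qed
    then show "\<exists>M. \<forall>p\<ge>M. \<forall>q\<ge>M. norm (u p - u q) < e" by blast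
  qed
  then obtain g where g: "u \<longlonglongrightarrow> g"
    using Cauchy_convergent convergent_def by blast
  have "(\<lambda>n. J (u n)) \<longlonglongrightarrow> J g"
    unfolding J_def by (intro tendsto_intros g f.tendsto)
  moreover have "(\<lambda>n. m + inverse (real (Suc n))) \<longlonglongrightarrow> m"
    using tendsto_add[OF tendsto_const LIMSEQ_inverse_real_of_nat, of m] by simp
  ultimately have "J g \<le> m"
    using u less_imp_le by (intro LIMSEQ_le[of _ "J g" _ m]) blast+
  then have min: "J g \<le> J y" for y using m_le[of y] by linarith
  have "f x = inner x g" for x
  proof (rule ccontr)
    assume ne: "f x \<noteq> inner x g"
    define d where "d = f x - inner x g"
    have "x \<noteq> 0" using ne by (auto simp: f.zero)
    define t where "t = d / (norm x)\<^sup>2"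
    have "J (g + t *\<^sub>R x) = J g - 2 * t * d + t\<^sup>2 * (norm x)\<^sup>2"
      unfolding J_def d_def power2_norm_eq_inner
      by (simp add: f.scaleR f.add inner_simps inner_commute algebra_simps power2_eq_square)
    also have "\<dots> = J g - d\<^sup>2 / (norm x)\<^sup>2"
      using \<open>x \<noteq> 0\<close> by (simp add: t_def field_simps power2_eq_square)
    finally have "J (g + t *\<^sub>R x) < J g"
      using ne \<open>x \<noteq> 0\<close> by (simp add: d_def)
    then show False using min[of "g + t *\<^sub>R x"] by linarith
  qed
  then show ?thesis using that by blast
qed

lemma cinner_eq_iff_right: "(\<forall>x. cinner x y = cinner x z) \<longleftrightarrow> y = (z :: 'a::complex_inner)"
proof
  assume "\<forall>x. cinner x y = cinner x z"
  then have "\<forall>x. inner x y = inner x z" by (simp add: inner_eq_Re_cinner)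
  then show "y = z" by (metis inner_commute vector_eq_ldot)
qed simp

lemma cinner_adj:
  fixes T :: "'a::complex_hilbert_space \<Rightarrow> 'a"
  assumes "bounded_operator T"
  shows "cinner (T x) y = cinner x (adj T y)"
proof -
  have bl: "bounded_linear T" and sc: "\<And>c x. T (c *\<^sub>C x) = c *\<^sub>C T x"
    using assms by (auto simp: bounded_operator_def)
  have "\<exists>g. \<forall>x. cinner (T x) y = cinner x g" for y
  proof -
    have "bounded_linear (\<lambda>x. inner (T x) y)"
      using bounded_linear_compose[OF bounded_linear_inner_left bl] by simp
    then obtain g where g: "\<And>x. inner (T x) y = inner x g" using real_riesz by blast
    have "cinner (T x) y = cinner x g" for x
    proof (rule complex_eqI)
      show "Re (cinner (T x) y) = Re (cinner x g)"
        using g by (simp add: inner_eq_Re_cinner)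
      have "Re (cinner (T ((- \<i>) *\<^sub>C x)) y) = Re (cinner ((- \<i>) *\<^sub>C x) g)"
        using g by (simp only: inner_eq_Re_cinner)
      then show "Im (cinner (T x) y) = Im (cinner x g)"
        by (simp only: sc cinner_scaleC_left) simp
    qed
    then show ?thesis by blast
  qed
  then obtain G where G: "\<forall>x y. cinner (T x) y = cinner x (G y)" by metis
  have "\<forall>x y. cinner (T x) y = cinner x (adj T y)"
    unfolding adj_def
  proof (rule theI[of _ G])
    show "G' = G" if "\<forall>x y. cinner (T x) y = cinner x (G' y)" for G'
      using that G by (metis cinner_eq_iff_right ext)
  qed (rule G)
  then show ?thesis by blast
qed

section \<open>The joint numerical range\<close>

definition orthonormal_family :: "nat \<Rightarrow> (nat \<Rightarrow> 'a::complex_inner) \<Rightarrow> bool" where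
  "orthonormal_family k x \<longleftrightarrow> (\<forall>i<k. \<forall>j<k. cinner (x i) (x j) = (if i = j then 1 else 0))"

definition joint_numerical_range ::
    "nat \<Rightarrow> ('m::finite \<Rightarrow> 'a::complex_inner \<Rightarrow> 'a) \<Rightarrow> (complex ^ 'm) set" where
  "joint_numerical_range k A =
     {(\<chi> j. \<Sum>l<k. cinner (A j (x l)) (x l)) | x. orthonormal_family k x}"

section \<open>Operator matrices\<close>

definition orth_compl :: "'a::complex_inner set \<Rightarrow> 'a set" where
  "orth_compl K = {y. \<forall>x\<in>K. cinner x y = 0}"

text \<open>
  \<open>has_blocks K T T11 T12 T21 T22\<close>: with respect to the decomposition into \<open>K\<close> and its orthogonal
  complement, \<open>T\<close> is the operator matrix with rows \<open>(T11, T12)\<close> and \<open>(T21, T22)\<close>. The entries are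
  total functions of which only the restrictions to \<open>K\<close> (first column) and to the complement
  (second column) matter.
\<close>

definition has_blocks ::
    "'a::complex_inner set \<Rightarrow> ('a \<Rightarrow> 'a) \<Rightarrow>
     ('a \<Rightarrow> 'a) \<Rightarrow> ('a \<Rightarrow> 'a) \<Rightarrow> ('a \<Rightarrow> 'a) \<Rightarrow> ('a \<Rightarrow> 'a) \<Rightarrow> bool" where
  "has_blocks K T T11 T12 T21 T22 \<longleftrightarrow>
     T11 \<in> K \<rightarrow> K \<and> T12 \<in> orth_compl K \<rightarrow> K \<and>
     T21 \<in> K \<rightarrow> orth_compl K \<and> T22 \<in> orth_compl K \<rightarrow> orth_compl K \<and>
     (\<forall>u\<in>K. \<forall>v\<in>orth_compl K. T (u + v) = (T11 u + T12 v) + (T21 u + T22 v))"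

text \<open>
  An identification of a \<open>k\<close>-dimensional subspace with \<open>k\<close>-dimensional column space is an
  orthonormal basis \<open>e 0, \<dots>, e (k - 1)\<close> of it. Only the entries of \<open>R\<close> with indices below \<open>k\<close>
  matter.
\<close>

definition matrix_operator ::
    "nat \<Rightarrow> (nat \<Rightarrow> 'a::complex_inner) \<Rightarrow> (nat \<Rightarrow> nat \<Rightarrow> complex) \<Rightarrow> 'a \<Rightarrow> 'a" where
  "matrix_operator k e R u = (\<Sum>i<k. (\<Sum>j<k. R i j * cinner u (e j)) *\<^sub>C e i)"

definition scalar_plus_off_diagonal :: "'a::complex_inner set \<Rightarrow> ('a \<Rightarrow> 'a) set" where
  "scalar_plus_off_diagonal K =
     {T. bounded_operator T \<and>
         (\<exists>a M R1 R2. T = (\<lambda>x. a *\<^sub>C x + M x) \<and> has_blocks K M (\<lambda>_. 0) R1 R2 (\<lambda>_. 0))}"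

definition matrix_plus_scalar ::
    "nat \<Rightarrow> (nat \<Rightarrow> 'a::complex_inner) \<Rightarrow> 'a set \<Rightarrow> ('a \<Rightarrow> 'a) set" where
  "matrix_plus_scalar k e K =
     {T. bounded_operator T \<and>
         (\<exists>R \<alpha>. has_blocks K T (matrix_operator k e R) (\<lambda>_. 0) (\<lambda>_. 0) (\<lambda>v. \<alpha> *\<^sub>C v))}"

end

theory Submission
  imports Defs
begin

text \<open>
  Let \<open>E\<close> be the orthogonal projection onto the fixed \<open>k\<close>-dimensional subspace and \<open>P\<close> the projection
  onto the span of an orthonormal \<open>k\<close>-tuple. In case (2) the point of the numerical range is an affine
  function of the compression \<open>EPE\<close>, in case (1) it is a real affine function of the block
  \<open>G = (1 - E)PE\<close>. The compressions form the convex set \<open>0 \<le> C \<le> 1\<close>, the off-diagonal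
  blocks the convex set \<open>\<parallel>G\<parallel> \<le> 1/2\<close>: if \<open>f\<close> is an orthonormal basis of the subspace diagonalizing
  \<open>C\<close> with eigenvalues \<open>c\<^sub>i\<close>, the vectors \<open>\<surd>c\<^sub>i f\<^sub>i + \<surd>(1 - c\<^sub>i) g\<^sub>i\<close> with \<open>g\<close> orthonormal in the
  complement realize \<open>C\<close>; if \<open>f\<close> diagonalizes \<open>G\<^sup>*G\<close>, the vectors \<open>c\<^sub>i f\<^sub>i + c\<^sub>i\<^sup>-\<^sup>1 G f\<^sub>i\<close> with
  \<open>c\<^sub>i\<^sup>2 + \<parallel>G f\<^sub>i\<parallel>\<^sup>2 / c\<^sub>i\<^sup>2 = 1\<close> realize \<open>G\<close>.
\<close>

section \<open>Complex inner product spaces\<close>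

lemma cinner_add_right: "cinner x (y + z) = cinner x y + cinner x z"
  by (metis cinner_add_left cinner_commute complex_cnj_add)

lemma cinner_scaleC_right: "cinner x (a *\<^sub>C y) = cnj a * cinner x y"
  by (metis cinner_scaleC_left cinner_commute complex_cnj_mult)

lemma cinner_zero_left [simp]: "cinner 0 x = 0"
  using cinner_add_left[of 0 0 x] by simp

lemma cinner_zero_right [simp]: "cinner x 0 = 0"
  using cinner_add_right[of x 0 0] by simp

lemma cinner_diff_left: "cinner (x - y) z = cinner x z - cinner y z"
  using cinner_add_left[of "x - y" y z] by simp

lemma cinner_diff_right: "cinner x (y - z) = cinner x y - cinner x z"
  using cinner_add_right[of x "y - z" z] by simp

lemma cinner_sum_left: "cinner (sum f I) x = (\<Sum>i\<in>I. cinner (f i) x)"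
  by (induction I rule: infinite_finite_induct) (simp_all add: cinner_add_left)

lemma cinner_sum_right: "cinner x (sum f I) = (\<Sum>i\<in>I. cinner x (f i))"
  by (induction I rule: infinite_finite_induct) (simp_all add: cinner_add_right)

lemmas cinner_simps = cinner_add_left cinner_add_right cinner_diff_left cinner_diff_right
  cinner_scaleC_left cinner_scaleC_right

lemma cinner_self: "cinner x x = complex_of_real ((norm x)\<^sup>2)"
proof (rule complex_eqI)
  show "Re (cinner x x) = Re (complex_of_real ((norm x)\<^sup>2))"
    by (simp add: power2_norm_eq_inner inner_eq_Re_cinner)
  show "Im (cinner x x) = Im (complex_of_real ((norm x)\<^sup>2))"
    using arg_cong[OF cinner_commute[of x x], of Im] by simp
qed

lemma cinner_eq_0_commute: "cinner x y = 0 \<longleftrightarrow> cinner y x = 0"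
  by (metis cinner_commute complex_cnj_zero)

lemma norm_scaleC: "norm (a *\<^sub>C x) = cmod a * norm (x :: 'a::complex_inner)"
proof -
  have "complex_of_real ((norm (a *\<^sub>C x))\<^sup>2) = complex_of_real ((cmod a * norm x)\<^sup>2)"
    unfolding cinner_self[symmetric] power_mult_distrib of_real_mult complex_norm_square
    by (simp only: cinner_simps mult_ac)
  then have "(norm (a *\<^sub>C x))\<^sup>2 = (cmod a * norm x)\<^sup>2" by (simp only: of_real_eq_iff)
  then show ?thesis by (simp add: power2_eq_iff_nonneg)
qed

text \<open>Multiplying \<open>x\<close> by a unimodular \<open>a\<close> makes the product real and
  nonnegative, so the real Cauchy-Schwarz inequality already bounds its modulus.\<close>

lemma norm_cinner_le: "cmod (cinner x y) \<le> norm x * norm y"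
proof (cases "cinner x y = 0")
  case False
  define a where "a = cnj (cinner x y) / cmod (cinner x y)"
  have "a * cinner x y = complex_of_real (cmod (cinner x y))"
    using False complex_norm_square[of "cinner x y"]
    by (simp add: a_def field_simps power2_eq_square)
  then have "cmod (cinner x y) = Re (cinner (a *\<^sub>C x) y)" by (simp add: cinner_simps)
  also have "\<dots> \<le> norm (a *\<^sub>C x) * norm y"
    unfolding inner_eq_Re_cinner[symmetric] by (rule norm_cauchy_schwarz)
  finally show ?thesis using False by (simp add: a_def norm_scaleC norm_divide)
qed simp

lemma bounded_linear_cinner_left: "bounded_linear (\<lambda>x. cinner x y)"
proof (rule bounded_linear_intro[of _ "norm y"])
  show "cinner (r *\<^sub>R x) y = r *\<^sub>R cinner x y" for r x
    by (simp add: scaleR_scaleC cinner_simps scaleR_conv_of_real)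
qed (simp_all add: cinner_simps norm_cinner_le)

lemma bounded_linear_scaleC_left: "bounded_linear (\<lambda>a. a *\<^sub>C x)"
proof (rule bounded_linear_intro[of _ "norm x"])
  show "(r *\<^sub>R a) *\<^sub>C x = r *\<^sub>R (a *\<^sub>C x)" for r a
    by (simp add: scaleR_scaleC scaleC_scaleC scaleR_conv_of_real)
qed (simp_all add: scaleC_add_left norm_scaleC)

lemma bounded_linear_scaleC_right: "bounded_linear (\<lambda>x. a *\<^sub>C x)"
proof (rule bounded_linear_intro[of _ "cmod a"])
  show "a *\<^sub>C (r *\<^sub>R x) = r *\<^sub>R (a *\<^sub>C x)" for r x
    by (simp add: scaleR_scaleC scaleC_scaleC mult.commute)
qed (simp_all add: scaleC_add_right norm_scaleC mult.commute)

section \<open>Bounded complex-linear operators\<close>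

lemma bounded_operator_bounded_linear: "bounded_operator T \<Longrightarrow> bounded_linear T"
  by (simp add: bounded_operator_def)

lemma
  assumes "bounded_operator T"
  shows bounded_operator_add: "T (x + y) = T x + T y"
    and bounded_operator_diff: "T (x - y) = T x - T y"
    and bounded_operator_zero: "T 0 = 0"
    and bounded_operator_sum: "T (sum f I) = (\<Sum>i\<in>I. T (f i))"
    and bounded_operator_scaleC: "T (c *\<^sub>C x) = c *\<^sub>C T x"
proof -
  interpret bounded_linear T using assms by (rule bounded_operator_bounded_linear)
  show "T (x + y) = T x + T y" by (rule add)
  show "T (x - y) = T x - T y" by (rule diff)
  show "T 0 = 0" by (rule zero)
  show "T (sum f I) = (\<Sum>i\<in>I. T (f i))" by (rule sum)
  show "T (c *\<^sub>C x) = c *\<^sub>C T x" using assms by (simp add: bounded_operator_def)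
qed

lemmas bounded_operator_simps = bounded_operator_add bounded_operator_diff bounded_operator_zero
  bounded_operator_sum bounded_operator_scaleC

lemma bounded_operator_id: "bounded_operator (\<lambda>x. x)"
  by (simp add: bounded_operator_def)

lemma bounded_operator_plus:
  "bounded_operator S \<Longrightarrow> bounded_operator T \<Longrightarrow> bounded_operator (\<lambda>x. S x + T x)"
  by (simp add: bounded_operator_def bounded_linear_add scaleC_add_right)

lemma bounded_operator_minus:
  "bounded_operator S \<Longrightarrow> bounded_operator T \<Longrightarrow> bounded_operator (\<lambda>x. S x - T x)"
  by (simp add: bounded_operator_def bounded_linear_sub complex_space.scale_right_diff_distrib)

lemma bounded_operator_scale:
  "bounded_operator T \<Longrightarrow> bounded_operator (\<lambda>x. a *\<^sub>C T x)"
  by (auto simp: bounded_operator_def scaleC_scaleC mult.commute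
      intro: bounded_linear_compose[OF bounded_linear_scaleC_right])

lemma bounded_operator_compose:
  "bounded_operator S \<Longrightarrow> bounded_operator T \<Longrightarrow> bounded_operator (\<lambda>x. S (T x))"
  by (simp add: bounded_operator_def bounded_linear_compose)

section \<open>Orthonormal families\<close>

lemma orthonormal_familyD:
  "orthonormal_family k f \<Longrightarrow> i < k \<Longrightarrow> j < k \<Longrightarrow> cinner (f i) (f j) = (if i = j then 1 else 0)"
  by (simp add: orthonormal_family_def)

lemma orthonormal_family_norm:
  assumes "orthonormal_family k f" "i < k"
  shows "norm (f i) = 1"
proof -
  have "complex_of_real ((norm (f i))\<^sup>2) = 1"
    using assms cinner_self[of "f i"] by (simp add: orthonormal_familyD)
  then have "(norm (f i))\<^sup>2 = 1\<^sup>2" by (simp only: of_real_eq_1_iff power_one)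
  then show ?thesis by (rule power2_eq_imp_eq) simp_all
qed

text \<open>For an orthonormal \<open>f\<close> this is the orthogonal projection onto its span.
  Membership in the span and in the orthogonal complement become the equations
  \<open>orth_proj k f u = u\<close> and \<open>orth_proj k f u = 0\<close>, in which the later
  arguments are phrased.\<close>

definition orth_proj :: "nat \<Rightarrow> (nat \<Rightarrow> 'a::complex_inner) \<Rightarrow> 'a \<Rightarrow> 'a" where
  "orth_proj k f u = (\<Sum>i<k. cinner u (f i) *\<^sub>C f i)"

lemma bounded_operator_orth_proj: "bounded_operator (orth_proj k f)"
  unfolding bounded_operator_def orth_proj_def
proof (intro conjI allI)
  show "bounded_linear (\<lambda>u. \<Sum>i<k. cinner u (f i) *\<^sub>C f i)"
    by (intro bounded_linear_sum
        bounded_linear_compose[OF bounded_linear_scaleC_left bounded_linear_cinner_left])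
  show "(\<Sum>i<k. cinner (c *\<^sub>C u) (f i) *\<^sub>C f i) = c *\<^sub>C (\<Sum>i<k. cinner u (f i) *\<^sub>C f i)" for c u
    by (simp add: cinner_simps scaleC_scaleC complex_space.scale_sum_right)
qed

lemmas orth_proj_simps = bounded_operator_simps[OF bounded_operator_orth_proj]

lemma cinner_orth_proj_left: "cinner (orth_proj k f u) v = (\<Sum>i<k. cinner u (f i) * cinner (f i) v)"
  by (simp add: orth_proj_def cinner_sum_left cinner_simps)

lemma cinner_orth_proj_swap: "cinner (orth_proj k f u) v = cinner u (orth_proj k f v)"
  by (simp add: orth_proj_def cinner_sum_left cinner_sum_right cinner_simps
      mult.commute flip: cinner_commute)

lemma cinner_orth_proj_basis:
  assumes "orthonormal_family k f" "j < k"
  shows "cinner (orth_proj k f u) (f j) = cinner u (f j)"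
proof -
  have "cinner (orth_proj k f u) (f j) = (\<Sum>i<k. if i = j then cinner u (f i) else 0)"
    unfolding cinner_orth_proj_left using assms
    by (intro sum.cong) (auto simp: orthonormal_familyD)
  then show ?thesis using assms by simp
qed

lemma orth_proj_idem:
  assumes "orthonormal_family k f"
  shows "orth_proj k f (orth_proj k f u) = orth_proj k f u"
proof -
  have "orth_proj k f (orth_proj k f u) = (\<Sum>i<k. cinner (orth_proj k f u) (f i) *\<^sub>C f i)"
    by (rule orth_proj_def)
  also have "\<dots> = (\<Sum>i<k. cinner u (f i) *\<^sub>C f i)"
    by (intro sum.cong refl) (simp add: cinner_orth_proj_basis[OF assms])
  finally show ?thesis by (simp only: orth_proj_def)
qed

lemma cinner_orth_proj_orth_proj:
  assumes "orthonormal_family k f"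
  shows "cinner (orth_proj k f u) (orth_proj k f v) = cinner (orth_proj k f u) v"
  by (metis assms cinner_orth_proj_swap orth_proj_idem)

lemma cinner_orth_proj_residual:
  assumes "orthonormal_family k f"
  shows "cinner (orth_proj k f u) (v - orth_proj k f v) = 0"
  by (simp add: cinner_simps cinner_orth_proj_orth_proj[OF assms])

lemma norm_orth_proj_residual:
  assumes "orthonormal_family k f"
  shows "(norm (u - orth_proj k f u))\<^sup>2 = (norm u)\<^sup>2 - (norm (orth_proj k f u))\<^sup>2"
proof -
  let ?p = "orth_proj k f u"
  have "inner ?p (u - ?p) = 0"
    by (simp add: inner_eq_Re_cinner cinner_orth_proj_residual[OF assms])
  then show ?thesis unfolding power2_norm_eq_inner by (simp add: inner_simps inner_commute)
qed

lemma norm_orth_proj_le: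
  assumes "orthonormal_family k f"
  shows "norm (orth_proj k f u) \<le> norm u"
proof (rule power2_le_imp_le)
  show "(norm (orth_proj k f u))\<^sup>2 \<le> (norm u)\<^sup>2"
    using norm_orth_proj_residual[OF assms, of u] zero_le_power2[of "norm (u - orth_proj k f u)"]
    by linarith
qed simp

lemma norm_orth_proj_sum:
  assumes "orthonormal_family k f"
  shows "(norm (orth_proj k f u))\<^sup>2 = (\<Sum>i<k. (cmod (cinner u (f i)))\<^sup>2)"
proof -
  have "complex_of_real ((norm (orth_proj k f u))\<^sup>2) = cinner (orth_proj k f u) u"
    by (metis cinner_orth_proj_orth_proj[OF assms] cinner_self)
  also have "\<dots> = complex_of_real (\<Sum>i<k. (cmod (cinner u (f i)))\<^sup>2)"
    unfolding cinner_orth_proj_left of_real_sum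
    by (intro sum.cong refl) (simp only: complex_norm_square cinner_commute[of "f _" u])
  finally show ?thesis by (simp only: of_real_eq_iff)
qed

lemma orth_proj_basis:
  assumes "orthonormal_family k f" "i < k"
  shows "orth_proj k f (f i) = f i"
proof -
  have "orth_proj k f (f i) = (\<Sum>j<k. if j = i then f i else 0)"
    unfolding orth_proj_def using assms
    by (intro sum.cong) (auto simp: orthonormal_familyD scaleC_one)
  then show ?thesis using assms by simp
qed

lemma span_orthonormal_iff:
  assumes "orthonormal_family k f"
  shows "u \<in> complex_space.span (f ` {..<k}) \<longleftrightarrow> orth_proj k f u = u"
proof
  assume "orth_proj k f u = u"
  moreover have "orth_proj k f u \<in> complex_space.span (f ` {..<k})"
    unfolding orth_proj_def
    by (intro complex_space.span_sum complex_space.span_scale complex_space.span_base) auto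
  ultimately show "u \<in> complex_space.span (f ` {..<k})" by simp
next
  assume "u \<in> complex_space.span (f ` {..<k})"
  then show "orth_proj k f u = u"
    by (induction rule: complex_space.span_induct_alt)
      (auto simp: orth_proj_simps orth_proj_basis[OF assms])
qed

lemma orth_compl_span_iff:
  assumes "orthonormal_family k f"
  shows "v \<in> orth_compl (complex_space.span (f ` {..<k})) \<longleftrightarrow> orth_proj k f v = 0"
proof
  assume "v \<in> orth_compl (complex_space.span (f ` {..<k}))"
  then have "cinner (f i) v = 0" if "i < k" for i
    using that complex_space.span_base[of "f i" "f ` {..<k}"] by (auto simp: orth_compl_def)
  then have "cinner v (f i) = 0" if "i < k" for i
    using that by (subst cinner_eq_0_commute)
  then show "orth_proj k f v = 0"
    unfolding orth_proj_def by simp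
next
  assume v: "orth_proj k f v = 0"
  show "v \<in> orth_compl (complex_space.span (f ` {..<k}))"
    unfolding orth_compl_def mem_Collect_eq
  proof
    fix u assume "u \<in> complex_space.span (f ` {..<k})"
    then have "cinner u v = cinner u (orth_proj k f v)"
      by (simp add: span_orthonormal_iff[OF assms] flip: cinner_orth_proj_swap)
    then show "cinner u v = 0" using v by simp
  qed
qed

text \<open>Both sides are the double sum of the squared moduli of
  \<open>cinner (e i) (f j)\<close>, that is, the trace of the product of two projections. It takes
  the place of dimension counting below.\<close>

lemma sum_norm_orth_proj_swap:
  assumes "orthonormal_family n f" "orthonormal_family k e"
  shows "(\<Sum>i<k. (norm (orth_proj n f (e i)))\<^sup>2) = (\<Sum>j<n. (norm (orth_proj k e (f j)))\<^sup>2)"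
proof -
  have "cmod (cinner (e i) (f j)) = cmod (cinner (f j) (e i))" for i j
    by (metis cinner_commute complex_mod_cnj)
  then show ?thesis
    unfolding norm_orth_proj_sum[OF assms(1)] norm_orth_proj_sum[OF assms(2)]
    by (subst sum.swap) simp
qed

text \<open>The squared distances of the \<open>e i\<close> from the span of \<open>f\<close> add up
  to \<open>k - k = 0\<close> by the exchange of sums, so each \<open>e i\<close> lies in that span.
  Conversely, what is orthogonal to \<open>e\<close> is orthogonal to \<open>f\<close>, because each
  \<open>f i\<close> lies in the span of \<open>e\<close>.\<close>

lemma orth_proj_cong_span:
  assumes e: "orthonormal_family k e" and f: "orthonormal_family k f"
    and sub: "\<And>i. i < k \<Longrightarrow> orth_proj k e (f i) = f i"
  shows "orth_proj k f = orth_proj k e"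
proof
  fix u
  have "(\<Sum>i<k. (norm (e i - orth_proj k f (e i)))\<^sup>2)
      = (\<Sum>i<k. 1 - (norm (orth_proj k f (e i)))\<^sup>2)"
    by (intro sum.cong) (simp_all add: norm_orth_proj_residual[OF f] orthonormal_family_norm[OF e])
  also have "\<dots> = 0"
    unfolding sum_subtractf sum_norm_orth_proj_swap[OF f e]
    by (simp add: sub orthonormal_family_norm[OF f])
  finally have "e i - orth_proj k f (e i) = 0" if "i < k" for i
    using that by (subst (asm) sum_nonneg_eq_0_iff) auto
  then have "orth_proj k f (e i) = e i" if "i < k" for i using that by simp
  then have 1: "orth_proj k f (orth_proj k e u) = orth_proj k e u"
    unfolding orth_proj_def[of k e] by (simp add: orth_proj_simps)
  have "cinner (u - orth_proj k e u) (f i) = 0" if "i < k" for i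
    using that by (metis sub cinner_eq_0_commute cinner_orth_proj_residual[OF e])
  then have "orth_proj k f (u - orth_proj k e u) = 0"
    unfolding orth_proj_def[of k f] by simp
  with 1 show "orth_proj k f u = orth_proj k e u" by (simp add: orth_proj_simps)
qed

section \<open>Diagonalization of Hermitian forms\<close>

text \<open>Provides a compact superset for the unit sphere of a finite-dimensional subspace, even
  when the whole space is not locally compact. It is an iterated continuous image of products with
  the closed unit disc.\<close>

lemma compact_combinations:
  fixes f :: "nat \<Rightarrow> 'a::complex_inner"
  shows "\<exists>C. compact C \<and> (\<forall>c. (\<forall>i<k. cmod (c i) \<le> 1) \<longrightarrow> (\<Sum>i<k. c i *\<^sub>C f i) \<in> C)"
proof (induction k)
  case 0
  show ?case by (intro exI[of _ "{0}"]) simp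
next
  case (Suc k)
  then obtain C where C: "compact C"
    "\<And>c. \<forall>i<k. cmod (c i) \<le> 1 \<Longrightarrow> (\<Sum>i<k. c i *\<^sub>C f i) \<in> C" by blast
  let ?C = "(\<lambda>p. fst p + snd p *\<^sub>C f k) ` (C \<times> cball 0 1)"
  have "continuous_on (C \<times> cball 0 1) (\<lambda>p. fst p + snd p *\<^sub>C f k)"
    by (intro continuous_intros
        bounded_linear.continuous_on[OF bounded_linear_scaleC_left])
  then have "compact ?C" using C(1) by (intro compact_continuous_image compact_Times) auto
  moreover have "(\<Sum>i<Suc k. c i *\<^sub>C f i) \<in> ?C" if "\<forall>i<Suc k. cmod (c i) \<le> 1" for c
    using that C(2)[of c] by (intro image_eqI[of _ _ "(\<Sum>i<k. c i *\<^sub>C f i, c k)"]) auto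
  ultimately show ?case by blast
qed

section \<open>Adjoining one vector to an orthonormal family\<close>

lemma orthonormal_family_Suc:
  assumes "orthonormal_family n f" "norm x = 1" "\<And>i. i < n \<Longrightarrow> cinner x (f i) = 0"
  shows "orthonormal_family (Suc n) (f(n := x))"
  using assms cinner_self[of x] cinner_eq_0_commute[of x]
  by (auto simp: orthonormal_family_def less_Suc_eq)

lemma normalized_residual:
  fixes f :: "nat \<Rightarrow> 'a::complex_inner"
  assumes f: "orthonormal_family n f" and ne: "orth_proj n f u \<noteq> u"
  defines "w \<equiv> u - orth_proj n f u"
  shows "norm (complex_of_real (inverse (norm w)) *\<^sub>C w) = 1"
    and "i < n \<Longrightarrow> cinner (complex_of_real (inverse (norm w)) *\<^sub>C w) (f i) = 0"
proof -
  have "w \<noteq> 0" using ne by (simp add: w_def)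
  then show "norm (complex_of_real (inverse (norm w)) *\<^sub>C w) = 1"
    by (simp add: norm_scaleC norm_inverse)
  show "cinner (complex_of_real (inverse (norm w)) *\<^sub>C w) (f i) = 0" if "i < n"
    using that by (simp add: cinner_simps w_def cinner_orth_proj_basis[OF f])
qed

text \<open>If every \<open>e j\<close> lay in the span of \<open>f\<close>, the exchange of sums
  would give \<open>k = n\<close>. Hence some \<open>e j\<close> has a nonzero residual, which stays
  in the span of \<open>e\<close> and can be normalized.\<close>

lemma exists_unit_orthogonal_in_span:
  assumes e: "orthonormal_family k e" and f: "orthonormal_family n f" and "n < k"
    and sub: "\<And>i. i < n \<Longrightarrow> orth_proj k e (f i) = f i"
  obtains x where "orth_proj k e x = x" "norm x = 1" "\<And>i. i < n \<Longrightarrow> cinner x (f i) = 0"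
proof -
  have "\<exists>j<k. orth_proj n f (e j) \<noteq> e j"
  proof (rule ccontr)
    assume "\<not> ?thesis"
    then have "(\<Sum>j<k. (norm (orth_proj n f (e j)))\<^sup>2) = real k"
      by (simp add: orthonormal_family_norm[OF e])
    moreover have "(\<Sum>i<n. (norm (orth_proj k e (f i)))\<^sup>2) = real n"
      by (simp add: sub orthonormal_family_norm[OF f])
    ultimately show False
      using sum_norm_orth_proj_swap[OF f e] \<open>n < k\<close> by simp
  qed
  then obtain j where j: "j < k" "orth_proj n f (e j) \<noteq> e j" by blast
  define w where "w = e j - orth_proj n f (e j)"
  have "orth_proj k e (orth_proj n f (e j)) = orth_proj n f (e j)"
    unfolding orth_proj_def[of n f] by (simp add: orth_proj_simps sub)
  then have "orth_proj k e w = w"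
    using j by (simp add: w_def orth_proj_simps orth_proj_basis[OF e])
  then show thesis
    using normalized_residual[OF f j(2)] that[of "complex_of_real (inverse (norm w)) *\<^sub>C w"]
    by (simp add: w_def orth_proj_simps)
qed

text \<open>A quadratic bound cannot dominate a nonzero linear term near \<open>t = 0\<close>; this
  extracts the first-order condition at a maximum.\<close>

lemma linear_coefficient_zero:
  fixes b d :: real
  assumes "\<And>t. 2 * t * b \<le> t\<^sup>2 * d"
  shows "b = 0"
proof (rule ccontr)
  assume "b \<noteq> 0"
  \<comment> \<open>The denominator is positive even for \<open>d = 0\<close>, and this
    \<open>t\<close> turns \<open>t\<^sup>2 * (\<bar>d\<bar> + 1)\<close> into \<open>t * b\<close>,
    half of the left-hand side.\<close>
  define t where "t = b / (\<bar>d\<bar> + 1)"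
  have "t\<^sup>2 * d \<le> t\<^sup>2 * (\<bar>d\<bar> + 1)" by (intro mult_left_mono) auto
  also have "\<dots> = t * b" by (simp add: t_def power2_eq_square)
  finally have "2 * (t * b) \<le> t * b" using assms[of t] by (simp only: mult.assoc)
  moreover have "t * b > 0" using \<open>b \<noteq> 0\<close>
    by (simp add: t_def zero_less_mult_iff zero_less_divide_iff divide_less_0_iff) linarith
  ultimately show False by linarith
qed

text \<open>Maximizing the Rayleigh quotient over the orthogonal complement of the vectors found so far
  yields the next vector; the first-order condition at the maximum is orthogonality for the form.\<close>

lemma hermitian_form_maximizer:
  fixes B :: "'a::complex_inner \<Rightarrow> 'a \<Rightarrow> complex"
  assumes e: "orthonormal_family k e" and f: "orthonormal_family n f" and "n < k"
    and sub: "\<And>i. i < n \<Longrightarrow> orth_proj k e (f i) = f i"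
    and add: "\<And>u v w. B (u + v) w = B u w + B v w"
    and scale: "\<And>c u w. B (c *\<^sub>C u) w = c * B u w"
    and herm: "\<And>u v. B u v = cnj (B v u)"
    and cont: "continuous_on UNIV (\<lambda>u. Re (B u u))"
  obtains x where "orth_proj k e x = x" "norm x = 1" "\<And>i. i < n \<Longrightarrow> cinner x (f i) = 0"
    "\<And>y. orth_proj k e y = y \<Longrightarrow> (\<And>i. i < n \<Longrightarrow> cinner y (f i) = 0) \<Longrightarrow> cinner y x = 0 \<Longrightarrow> B y x = 0"
proof -
  \<comment> \<open>\<open>V\<close> is the part of the subspace orthogonal to the vectors already
    chosen, and \<open>S\<close> its unit sphere: closed, inside a compact set, and nonempty because
    \<open>n < k\<close>.\<close>
  define V where "V = {u. orth_proj k e u = u} \<inter> (\<Inter>i\<in>{..<n}. {u. cinner u (f i) = 0})"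
  define S where "S = V \<inter> {u. norm u = 1}"
  obtain C where C: "compact C"
    "\<And>c. (\<forall>i<k. cmod (c i) \<le> 1) \<Longrightarrow> (\<Sum>i<k. c i *\<^sub>C e i) \<in> C"
    using compact_combinations[of k e] by blast
  have "S \<subseteq> C"
  proof
    fix u assume "u \<in> S"
    then have u: "orth_proj k e u = u" "norm u = 1" by (auto simp: S_def V_def)
    then have "\<forall>i<k. cmod (cinner u (e i)) \<le> 1"
      by (metis norm_cinner_le orthonormal_family_norm[OF e] mult_1)
    then have "orth_proj k e u \<in> C" unfolding orth_proj_def by (rule C(2))
    with u show "u \<in> C" by simp
  qed
  moreover have "closed S"
    unfolding S_def V_def
    by (intro closed_Int closed_INT ballI closed_Collect_eq continuous_intros
        linear_continuous_on bounded_linear_cinner_left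
        bounded_operator_bounded_linear bounded_operator_orth_proj)
  ultimately have "compact S" using C(1) by (metis compact_Int_closed inf.absorb_iff2)
  moreover have "S \<noteq> {}"
  proof -
    obtain u where "orth_proj k e u = u" "norm u = 1" "\<And>i. i < n \<Longrightarrow> cinner u (f i) = 0"
      using exists_unit_orthogonal_in_span[OF e f \<open>n < k\<close> sub] by blast
    then have "u \<in> S" by (simp add: S_def V_def)
    then show ?thesis by blast
  qed
  ultimately obtain x where x: "x \<in> S" "\<And>u. u \<in> S \<Longrightarrow> Re (B u u) \<le> Re (B x x)"
    using continuous_attains_sup[of S "\<lambda>u. Re (B u u)"] continuous_on_subset[OF cont] by blast
  have add': "B u (v + w) = B u v + B u w" for u v w
    by (metis add herm complex_cnj_add)
  have scale': "B u (c *\<^sub>C v) = cnj c * B u v" for c u v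
    by (metis scale herm complex_cnj_mult)
  have norm_x: "norm x = 1" and "x \<in> V" using x(1) by (auto simp: S_def)
  have V_add: "u + v \<in> V" if "u \<in> V" "v \<in> V" for u v
    using that by (auto simp: V_def orth_proj_simps cinner_simps)
  have V_scale: "c *\<^sub>C u \<in> V" if "u \<in> V" for c u
    using that by (auto simp: V_def orth_proj_simps cinner_simps)
  \<comment> \<open>Homogeneity carries the maximum on the unit sphere to all of \<open>V\<close>,
    so perturbations of \<open>x\<close> need not be normalized.\<close>
  have le: "Re (B u u) \<le> Re (B x x) * (norm u)\<^sup>2" if "u \<in> V" for u
  proof (cases "u = 0")
    case True
    then show ?thesis using scale[of 0 u u] by simp
  next
    case False
    let ?c = "complex_of_real (inverse (norm u))"
    have "?c *\<^sub>C u \<in> S"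
      using V_scale[OF that] False by (simp add: S_def norm_scaleC norm_inverse)
    then have "Re (B (?c *\<^sub>C u) (?c *\<^sub>C u)) \<le> Re (B x x)" by (rule x(2))
    then have "Re (B u u) / (norm u)\<^sup>2 \<le> Re (B x x)"
      by (simp add: scale scale' power2_eq_square field_simps)
    then show ?thesis using False by (simp add: field_simps)
  qed
  have "B y x = 0" if y: "y \<in> V" "cinner y x = 0" for y
  proof -
    \<comment> \<open>Rescaling \<open>y\<close> by \<open>cnj (B y x)\<close> makes
      \<open>B ?z x\<close> real, so perturbing \<open>x\<close> by \<open>t\<close> times
      \<open>?z\<close> gives the first-order term \<open>2 * t * ?b\<close>. Maximality leaves only
      terms of order \<open>t\<^sup>2\<close> against it.\<close>
    let ?b = "(cmod (B y x))\<^sup>2" and ?z = "cnj (B y x) *\<^sub>C y"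
    have "2 * t * ?b \<le> t\<^sup>2 * (Re (B x x) * (norm ?z)\<^sup>2 - Re (B ?z ?z))" for t
    proof -
      let ?w = "x + complex_of_real t *\<^sub>C ?z"
      have zx: "B ?z x = complex_of_real ?b"
        by (simp only: scale complex_norm_square mult.commute)
      then have xz: "B x ?z = complex_of_real ?b" by (metis herm complex_cnj_complex_of_real)
      have "Re (B ?w ?w) = Re (B x x) + 2 * t * ?b + t\<^sup>2 * Re (B ?z ?z)"
        by (simp only: add add' scale[of "complex_of_real t" ?z] scale'[of _ "complex_of_real t" ?z]
            zx xz) (simp add: power2_eq_square algebra_simps)
      moreover have "(norm ?w)\<^sup>2 = 1 + t\<^sup>2 * (norm ?z)\<^sup>2"
      proof -
        have "cinner x y = 0" using y(2) by (simp only: cinner_eq_0_commute[of x])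
        then have "complex_of_real ((norm ?w)\<^sup>2)
            = cinner x x + complex_of_real t * complex_of_real t * cinner ?z ?z"
          unfolding cinner_self[symmetric] using y(2)
          by (simp add: cinner_simps algebra_simps)
        also have "\<dots> = complex_of_real (1 + t\<^sup>2 * (norm ?z)\<^sup>2)"
          unfolding cinner_self norm_x by (simp add: power2_eq_square)
        finally show ?thesis by (simp only: of_real_eq_iff)
      qed
      moreover have "?w \<in> V" using \<open>x \<in> V\<close> y(1) by (intro V_add V_scale)
      ultimately show ?thesis using le[of ?w] by (simp add: algebra_simps)
    qed
    then have "?b = 0" by (rule linear_coefficient_zero)
    then show ?thesis by simp
  qed
  then show thesis using \<open>x \<in> V\<close> norm_x by (intro that[of x]) (auto simp: V_def)
qed

text \<open>A form rather than an operator is diagonalized, so that one statement serves both the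
  compression \<open>cinner (D u) v\<close> and the Gram form \<open>cinner (G u) (G v)\<close>. The
  basis is found one maximizer at a time.\<close>

lemma hermitian_form_diagonalization:
  fixes B :: "'a::complex_inner \<Rightarrow> 'a \<Rightarrow> complex"
  assumes e: "orthonormal_family k e"
    and add: "\<And>u v w. B (u + v) w = B u w + B v w"
    and scale: "\<And>c u w. B (c *\<^sub>C u) w = c * B u w"
    and herm: "\<And>u v. B u v = cnj (B v u)"
    and cont: "continuous_on UNIV (\<lambda>u. Re (B u u))"
  obtains f where "orthonormal_family k f" "orth_proj k f = orth_proj k e"
    "\<And>i j. i < k \<Longrightarrow> j < k \<Longrightarrow> i \<noteq> j \<Longrightarrow> B (f i) (f j) = 0"
proof -
  \<comment> \<open>The third clause drives the induction: everything in the subspace orthogonal to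
    the chosen vectors is also orthogonal to them for \<open>B\<close>. Applied to the next
    maximizer, it yields the new vanishing off-diagonal entries.\<close>
  have "\<exists>f. orthonormal_family n f \<and> (\<forall>i<n. orth_proj k e (f i) = f i) \<and>
      (\<forall>u. orth_proj k e u = u \<longrightarrow> (\<forall>i<n. cinner u (f i) = 0) \<longrightarrow> (\<forall>i<n. B u (f i) = 0)) \<and>
      (\<forall>i<n. \<forall>j<n. i \<noteq> j \<longrightarrow> B (f i) (f j) = 0)" if "n \<le> k" for n
    using that
  proof (induction n)
    case 0
    then show ?case by (simp add: orthonormal_family_def)
  next
    case (Suc n)
    then obtain f where f: "orthonormal_family n f" "\<forall>i<n. orth_proj k e (f i) = f i"
      and inv: "\<forall>u. orth_proj k e u = u \<longrightarrow> (\<forall>i<n. cinner u (f i) = 0) \<longrightarrow> (\<forall>i<n. B u (f i) = 0)"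
      and diag: "\<forall>i<n. \<forall>j<n. i \<noteq> j \<longrightarrow> B (f i) (f j) = 0"
      by auto
    have "n < k" using Suc.prems by simp
    obtain x where x: "orth_proj k e x = x" "norm x = 1" "\<And>i. i < n \<Longrightarrow> cinner x (f i) = 0"
      "\<And>y. orth_proj k e y = y \<Longrightarrow> (\<And>i. i < n \<Longrightarrow> cinner y (f i) = 0) \<Longrightarrow> cinner y x = 0 \<Longrightarrow> B y x = 0"
      by (rule hermitian_form_maximizer[where B = B, OF e f(1) \<open>n < k\<close> f(2)[rule_format] add scale herm cont]) blast+
    have xf: "B x (f i) = 0" if "i < n" for i using inv x(1,3) that by simp
    then have fx: "B (f i) x = 0" if "i < n" for i using that herm[of "f i" x] by simp
    have "orthonormal_family (Suc n) (f(n := x))"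
      using f(1) x(2,3) by (rule orthonormal_family_Suc)
    moreover have "\<forall>i<Suc n. orth_proj k e ((f(n := x)) i) = (f(n := x)) i"
      using f(2) x(1) by (simp add: less_Suc_eq)
    moreover have "\<forall>i<Suc n. \<forall>j<Suc n. i \<noteq> j \<longrightarrow> B ((f(n := x)) i) ((f(n := x)) j) = 0"
      using diag xf fx by (simp add: less_Suc_eq)
    moreover have "B u ((f(n := x)) i) = 0"
      if u: "orth_proj k e u = u" "\<forall>i<Suc n. cinner u ((f(n := x)) i) = 0" and i: "i < Suc n" for u i
    proof -
      have uf: "cinner u (f i) = 0" if "i < n" for i
        using u(2)[rule_format, of i] that by simp
      moreover have "cinner u x = 0" using u(2)[rule_format, of n] by simp
      ultimately show ?thesis
        using inv x(4)[OF u(1)] u(1) i by (auto simp: less_Suc_eq)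
    qed
    ultimately show ?case by (intro exI[of _ "f(n := x)"] conjI allI impI) (simp_all del: fun_upd_apply)
  qed
  from this[of k] obtain f where f: "orthonormal_family k f" "\<forall>i<k. orth_proj k e (f i) = f i"
    "\<forall>i<k. \<forall>j<k. i \<noteq> j \<longrightarrow> B (f i) (f j) = 0"
    by auto
  show thesis
    by (rule that[OF f(1) orth_proj_cong_span[OF e f(1)]]) (simp_all add: f)
qed

text \<open>A family of \<open>m\<close> vectors with \<open>m\<close> below the dimension, finite
  or not, cannot span the whole space, so some vector has a nonzero residual to be normalized and
  appended.\<close>

lemma extend_orthonormal_family:
  fixes f :: "nat \<Rightarrow> 'a::complex_hilbert_space"
  assumes f: "orthonormal_family n f" and "n \<le> N" "enat N \<le> hilbert_dim TYPE('a)"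
  shows "\<exists>g. orthonormal_family N g \<and> (\<forall>i<n. g i = f i)"
  using assms(2,3)
proof (induction N rule: dec_induct)
  case base
  show ?case using f by blast
next
  case (step m)
  have m: "enat m < hilbert_dim TYPE('a)"
    using step.prems by (metis Suc_ile_eq)
  then have "enat m \<le> hilbert_dim TYPE('a)" by (rule order.strict_implies_order)
  with step.IH obtain g where g: "orthonormal_family m g" "\<forall>i<n. g i = f i" by blast
  have "\<exists>u. orth_proj m g u \<noteq> u"
  proof (rule ccontr)
    assume "\<not> ?thesis"
    then have span: "complex_space.span (g ` {..<m}) = UNIV"
      using span_orthonormal_iff[OF g(1)] by blast
    then have "complex_space.dim (UNIV :: 'a set) \<le> card (g ` {..<m})"
      by (intro complex_space.dim_le_card) auto
    also have "\<dots> \<le> m" using card_image_le[of "{..<m}" g] by simp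
    finally have "complex_space.dim (UNIV :: 'a set) \<le> m" .
    moreover have "\<exists>B :: 'a set. finite B \<and> complex_space.span B = UNIV"
      using span by blast
    ultimately have "hilbert_dim TYPE('a) \<le> enat m" by (simp add: hilbert_dim_def)
    with m show False by simp
  qed
  then obtain u where u: "orth_proj m g u \<noteq> u" by blast
  from orthonormal_family_Suc[OF g(1) normalized_residual[OF g(1) u]]
  obtain x where "orthonormal_family (Suc m) (g(m := x))" by blast
  moreover have "\<forall>i<n. (g(m := x)) i = f i" using g(2) step.hyps by simp
  ultimately show ?case by blast
qed

section \<open>Traces of compressions\<close>

text \<open>Cyclicity of the trace in coordinates: both sides expand to the same finite double sum.
  Afterwards the family \<open>y\<close> enters only through its projection.\<close>

lemma trace_swap_left:
  assumes "bounded_operator T"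
  shows "(\<Sum>l<k. cinner (T (orth_proj m f (y l))) (y l)) = (\<Sum>i<m. cinner (T (f i)) (orth_proj k y (f i)))"
proof -
  have "(\<Sum>l<k. cinner (T (orth_proj m f (y l))) (y l))
      = (\<Sum>l<k. \<Sum>i<m. cinner (y l) (f i) * cinner (T (f i)) (y l))"
    by (simp add: orth_proj_def bounded_operator_simps[OF assms] cinner_sum_left cinner_simps)
  also have "\<dots> = (\<Sum>i<m. \<Sum>l<k. cinner (y l) (f i) * cinner (T (f i)) (y l))"
    by (rule sum.swap)
  also have "\<dots> = (\<Sum>i<m. cinner (T (f i)) (orth_proj k y (f i)))"
    by (simp add: orth_proj_def cinner_sum_right cinner_simps flip: cinner_commute)
  finally show ?thesis .
qed

lemma trace_swap_right:
  assumes "bounded_operator T"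
  shows "(\<Sum>l<k. cinner (T (y l)) (orth_proj m f (y l))) = (\<Sum>i<m. cinner (T (orth_proj k y (f i))) (f i))"
proof -
  have "(\<Sum>l<k. cinner (T (y l)) (orth_proj m f (y l)))
      = (\<Sum>l<k. \<Sum>i<m. cinner (f i) (y l) * cinner (T (y l)) (f i))"
    by (simp add: orth_proj_def cinner_sum_right cinner_simps flip: cinner_commute)
  also have "\<dots> = (\<Sum>i<m. \<Sum>l<k. cinner (f i) (y l) * cinner (T (y l)) (f i))"
    by (rule sum.swap)
  also have "\<dots> = (\<Sum>i<m. cinner (T (orth_proj k y (f i))) (f i))"
    by (simp add: orth_proj_def bounded_operator_simps[OF assms] cinner_sum_left cinner_simps)
  finally show ?thesis .
qed

text \<open>Each unit vector \<open>y l\<close> contributes \<alpha>. As \<open>T - \<alpha>\<close>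
  vanishes on the complement, the rest involves only the components
  \<open>orth_proj k f (y l)\<close>, and exchanging the families makes it real linear in the
  projection onto the span of \<open>y\<close>.\<close>

lemma sum_cinner_matrix_plus_scalar:
  assumes f: "orthonormal_family k f" and y: "orthonormal_family k y"
    and T: "bounded_operator T"
    and scalar: "\<And>v. orth_proj k f v = 0 \<Longrightarrow> T v = \<alpha> *\<^sub>C v"
  shows "(\<Sum>l<k. cinner (T (y l)) (y l))
    = of_nat k * \<alpha> + (\<Sum>i<k. cinner (T (f i) - \<alpha> *\<^sub>C f i) (orth_proj k y (f i)))"
proof -
  let ?N = "\<lambda>u. T u - \<alpha> *\<^sub>C u"
  have N: "bounded_operator ?N"
    by (intro bounded_operator_minus bounded_operator_scale bounded_operator_id T)
  have "cinner (T (y l)) (y l) = \<alpha> + cinner (?N (orth_proj k f (y l))) (y l)" if "l < k" for l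
  proof -
    have "orth_proj k f (y l - orth_proj k f (y l)) = 0"
      by (simp add: orth_proj_simps orth_proj_idem[OF f])
    then have "?N (y l - orth_proj k f (y l)) = 0" by (simp add: scalar)
    then have "?N (y l) = ?N (orth_proj k f (y l))"
      by (simp only: bounded_operator_diff[OF N] right_minus_eq)
    then have "T (y l) = \<alpha> *\<^sub>C y l + ?N (orth_proj k f (y l))"
      by (metis add_diff_cancel_left' diff_add_cancel add.commute)
    then show ?thesis
      using that by (simp only: cinner_add_left cinner_scaleC_left) (simp add: orthonormal_familyD[OF y])
  qed
  then have "(\<Sum>l<k. cinner (T (y l)) (y l))
      = of_nat k * \<alpha> + (\<Sum>l<k. cinner (?N (orth_proj k f (y l))) (y l))"
    by (simp add: sum.distrib)
  then show ?thesis by (simp only: trace_swap_left[OF N])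
qed

text \<open>\<open>M\<close> maps the subspace into the complement and the complement into the
  subspace, so only cross terms survive. After the exchange of families they depend on
  \<open>y\<close> through \<open>G y\<close> alone, one conjugate-linearly and the other linearly,
  hence together real linearly.\<close>

lemma sum_cinner_off_diagonal:
  assumes f: "orthonormal_family k f"
    and M: "bounded_operator M"
    and M1: "\<And>u. orth_proj k f u = u \<Longrightarrow> orth_proj k f (M u) = 0"
    and M2: "\<And>v. orth_proj k f v = 0 \<Longrightarrow> orth_proj k f (M v) = M v"
  defines "G \<equiv> \<lambda>y u. orth_proj k y u - orth_proj k f (orth_proj k y u)"
  shows "(\<Sum>l<k. cinner (M (y l)) (y l))
    = (\<Sum>i<k. cinner (M (f i)) (G y (f i)) + cinner (M (G y (f i))) (f i))"
proof -
  let ?E = "orth_proj k f"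
  \<comment> \<open>Composing \<open>M\<close> with the complementary projection puts the second
    cross term into the form of \<open>trace_swap_right\<close>, which then produces
    \<open>G y (f i)\<close>.\<close>
  have L: "bounded_operator (\<lambda>u. M (u - ?E u))"
    by (intro bounded_operator_compose[OF M] bounded_operator_minus bounded_operator_id
        bounded_operator_orth_proj)
  have res: "?E (u - ?E u) = 0" for u
    by (simp add: orth_proj_simps orth_proj_idem[OF f])
  have "cinner (M (y l)) (y l) = cinner (M (?E (y l))) (y l) + cinner (M (y l - ?E (y l))) (?E (y l))" for l
  proof -
    have "cinner (M (y l - ?E (y l))) (?E (y l)) = cinner (M (y l - ?E (y l))) (y l)"
      by (simp only: cinner_orth_proj_swap[symmetric] M2[OF res])
    then show ?thesis by (simp add: bounded_operator_diff[OF M] cinner_simps)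
  qed
  then have "(\<Sum>l<k. cinner (M (y l)) (y l))
      = (\<Sum>l<k. cinner (M (?E (y l))) (y l)) + (\<Sum>l<k. cinner (M (y l - ?E (y l))) (?E (y l)))"
    by (simp only: sum.distrib)
  also have "\<dots> = (\<Sum>i<k. cinner (M (f i)) (orth_proj k y (f i))) + (\<Sum>i<k. cinner (M (G y (f i))) (f i))"
    by (simp only: trace_swap_left[OF M] trace_swap_right[OF L] G_def)
  \<comment> \<open>\<open>M (f i)\<close> lies in the complement, so the component in the subspace
    may be subtracted from the other argument.\<close>
  also have "(\<Sum>i<k. cinner (M (f i)) (orth_proj k y (f i))) = (\<Sum>i<k. cinner (M (f i)) (G y (f i)))"
  proof (intro sum.cong refl)
    fix i assume "i \<in> {..<k}"
    then have "?E (M (f i)) = 0" using M1 orth_proj_basis[OF f] by simp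
    then have "cinner (M (f i)) (?E w) = 0" for w
      using cinner_orth_proj_swap[of k f "M (f i)" w] by simp
    then show "cinner (M (f i)) (orth_proj k y (f i)) = cinner (M (f i)) (G y (f i))"
      by (simp add: G_def cinner_diff_right)
  qed
  finally show ?thesis by (simp only: sum.distrib)
qed

section \<open>Convexity\<close>

lemma convex_joint_numerical_rangeI:
  fixes A :: "'m::finite \<Rightarrow> 'a::complex_inner \<Rightarrow> 'a"
  assumes "\<And>y z s t. orthonormal_family k y \<Longrightarrow> orthonormal_family k z \<Longrightarrow> 0 \<le> s \<Longrightarrow> 0 \<le> t \<Longrightarrow> s + t = 1 \<Longrightarrow>
    \<exists>x. orthonormal_family k x \<and> (\<forall>j. (\<Sum>l<k. cinner (A j (x l)) (x l)) =
      complex_of_real s * (\<Sum>l<k. cinner (A j (y l)) (y l)) +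
      complex_of_real t * (\<Sum>l<k. cinner (A j (z l)) (z l)))"
  shows "convex (joint_numerical_range k A)"
proof (rule convexI)
  fix p q s t
  assume "p \<in> joint_numerical_range k A" "q \<in> joint_numerical_range k A"
    and st: "0 \<le> s" "0 \<le> t" "s + t = (1::real)"
  then obtain y z where yz: "orthonormal_family k y" "orthonormal_family k z"
    and p: "p = (\<chi> j. \<Sum>l<k. cinner (A j (y l)) (y l))"
    and q: "q = (\<chi> j. \<Sum>l<k. cinner (A j (z l)) (z l))"
    by (auto simp: joint_numerical_range_def)
  from assms[OF yz st] obtain x where x: "orthonormal_family k x"
    "\<And>j. (\<Sum>l<k. cinner (A j (x l)) (x l)) =
      complex_of_real s * (\<Sum>l<k. cinner (A j (y l)) (y l)) +
      complex_of_real t * (\<Sum>l<k. cinner (A j (z l)) (z l))" by blast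
  have "s *\<^sub>R p + t *\<^sub>R q = (\<chi> j. \<Sum>l<k. cinner (A j (x l)) (x l))"
    by (simp add: vec_eq_iff p q x(2)) (simp add: scaleR_conv_of_real)
  then show "s *\<^sub>R p + t *\<^sub>R q \<in> joint_numerical_range k A"
    using x(1) unfolding joint_numerical_range_def by blast
qed

text \<open>Since \<open>A j - \<alpha> j\<close> preserves the subspace and kills the complement,
  only the diagonal entries of the averaged projection in a diagonalizing basis enter the point.
  Dimension \<open>2 * k\<close> leaves room in the complement for one orthonormal partner per basis
  vector.\<close>

lemma convex_matrix_plus_scalar:
  fixes A :: "'m::finite \<Rightarrow> 'a::complex_hilbert_space \<Rightarrow> 'a"
  assumes e: "orthonormal_family k e" and dim: "enat (2 * k) \<le> hilbert_dim TYPE('a)"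
    and A: "\<And>j. bounded_operator (A j)"
    and block: "\<And>j u. orth_proj k e u = u \<Longrightarrow> orth_proj k e (A j u) = A j u"
    and scalar: "\<And>j v. orth_proj k e v = 0 \<Longrightarrow> A j v = \<alpha> j *\<^sub>C v"
  shows "convex (joint_numerical_range k A)"
proof (rule convex_joint_numerical_rangeI)
  fix y z :: "nat \<Rightarrow> 'a" and s t :: real
  assume y: "orthonormal_family k y" and z: "orthonormal_family k z"
    and st: "0 \<le> s" "0 \<le> t" "s + t = 1"
  define D where "D u = complex_of_real s *\<^sub>C orth_proj k y u + complex_of_real t *\<^sub>C orth_proj k z u" for u
  have D: "bounded_operator D"
    unfolding D_def by (intro bounded_operator_plus bounded_operator_scale bounded_operator_orth_proj)
  have D_swap: "cinner (D u) v = cinner u (D v)" for u v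
    by (simp add: D_def cinner_simps cinner_orth_proj_swap)
  obtain f where f: "orthonormal_family k f" "orth_proj k f = orth_proj k e"
    and diag: "\<And>i j. i < k \<Longrightarrow> j < k \<Longrightarrow> i \<noteq> j \<Longrightarrow> cinner (D (f i)) (f j) = 0"
  proof (rule hermitian_form_diagonalization[where B = "\<lambda>u v. cinner (D u) v", OF e])
    show "cinner (D u) v = cnj (cinner (D v) u)" for u v
      by (metis D_swap cinner_commute)
    show "continuous_on UNIV (\<lambda>u. Re (cinner (D u) u))"
      unfolding inner_eq_Re_cinner[symmetric]
      by (intro continuous_intros linear_continuous_on bounded_operator_bounded_linear D)
  qed (auto simp: bounded_operator_simps[OF D] cinner_simps)
  \<comment> \<open>The entries below \<open>k\<close> are \<open>f\<close>; those from
    \<open>k\<close> to \<open>2 * k - 1\<close> are orthogonal to the subspace.\<close>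
  obtain g where g: "orthonormal_family (2 * k) g" "\<forall>i<k. g i = f i"
    using extend_orthonormal_family[OF f(1) _ dim] by auto
  define c where "c i = Re (cinner (D (f i)) (f i))" for i
  have P: "cinner (orth_proj k w u) u = complex_of_real ((norm (orth_proj k w u))\<^sup>2)"
    if "orthonormal_family k w" for w u
    by (metis that cinner_orth_proj_orth_proj cinner_self)
  have c: "cinner (D (f i)) (f i) = complex_of_real (c i)" for i
    by (simp add: c_def D_def cinner_simps P[OF y] P[OF z])
  have c01: "0 \<le> c i" "c i \<le> 1" if "i < k" for i
  proof -
    \<comment> \<open>The diagonal entry is a convex combination of squared lengths of projected
      unit vectors, which places it in \<open>[0, 1]\<close>.\<close>
    have ceq: "c i = s * (norm (orth_proj k y (f i)))\<^sup>2 + t * (norm (orth_proj k z (f i)))\<^sup>2"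
      by (simp add: c_def D_def cinner_simps P[OF y] P[OF z])
    then show "0 \<le> c i" using st by simp
    have "(norm (orth_proj k w (f i)))\<^sup>2 \<le> 1" if "orthonormal_family k w" for w
      using norm_orth_proj_le[OF that, of "f i"] orthonormal_family_norm[OF f(1) \<open>i < k\<close>]
      by (simp add: power_le_one)
    then have "c i \<le> s * 1 + t * 1"
      unfolding ceq using st y z by (intro add_mono mult_left_mono) auto
    then show "c i \<le> 1" using st by simp
  qed
  \<comment> \<open>The squared coefficients are \<open>c i\<close> and \<open>1 - c i\<close>, so
    \<open>x i\<close> is a unit vector and a form living on the subspace sees it with weight
    \<open>c i\<close>.\<close>
  define x where "x i = complex_of_real (sqrt (c i)) *\<^sub>C g i + complex_of_real (sqrt (1 - c i)) *\<^sub>C g (k + i)" for i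
  have g': "cinner (g i) (g j) = (if i = j then 1 else 0)" if "i < 2 * k" "j < 2 * k" for i j
    using orthonormal_familyD[OF g(1)] that .
  have sq: "complex_of_real (sqrt r) * complex_of_real (sqrt r) = complex_of_real r" if "0 \<le> r" for r
    by (metis of_real_mult real_sqrt_mult_self abs_of_nonneg that)
  have x: "orthonormal_family k x"
    unfolding orthonormal_family_def
    by (auto simp: x_def cinner_simps g' sq c01 algebra_simps simp flip: of_real_add)
  have "(\<Sum>l<k. cinner (A j (x l)) (x l)) =
      complex_of_real s * (\<Sum>l<k. cinner (A j (y l)) (y l)) +
      complex_of_real t * (\<Sum>l<k. cinner (A j (z l)) (z l))" for j
  proof -
    define N where "N u = A j u - \<alpha> j *\<^sub>C u" for u
    have scalar': "A j v = \<alpha> j *\<^sub>C v" if "orth_proj k f v = 0" for v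
      using scalar that by (simp add: f(2))
    \<comment> \<open>\<open>N (f i)\<close> lies in the span of \<open>f\<close>; after expanding
      it there, diagonality of \<open>D\<close> leaves only the summand with index
      \<open>i\<close>.\<close>
    have term_D: "cinner (N (f i)) (D (f i)) = complex_of_real (c i) * cinner (N (f i)) (f i)"
      if i: "i < k" for i
    proof -
      have "orth_proj k f (f i) = f i" using orth_proj_basis[OF f(1) i] .
      then have "orth_proj k f (N (f i)) = N (f i)"
        using block[of "f i" j] by (simp add: N_def f(2) orth_proj_simps)
      then have "cinner (N (f i)) (D (f i)) = (\<Sum>l<k. cinner (N (f i)) (f l) * cinner (f l) (D (f i)))"
        by (metis cinner_orth_proj_left)
      also have "\<dots> = (\<Sum>l<k. if l = i then cinner (N (f i)) (f i) * complex_of_real (c i) else 0)"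
        using i by (intro sum.cong) (auto simp: diag c simp flip: D_swap)
      finally show ?thesis using i by simp
    qed
    have Ax: "cinner (A j (x l)) (x l) = \<alpha> j + complex_of_real (c l) * cinner (N (f l)) (f l)"
      if l: "l < k" for l
    proof -
      have gl: "g l = f l" using g(2) l by simp
      have "orth_proj k f (g (k + l)) = 0"
        unfolding orth_proj_def
      proof (intro sum.neutral ballI)
        fix i assume "i \<in> {..<k}"
        then have "cinner (g (k + l)) (f i) = 0" using g'[of "k + l" i] g(2) l by simp
        then show "cinner (g (k + l)) (f i) *\<^sub>C f i = 0" by simp
      qed
      then have "A j (g (k + l)) = \<alpha> j *\<^sub>C g (k + l)" by (rule scalar')
      then have "A j (x l) = complex_of_real (sqrt (c l)) *\<^sub>C N (f l) + \<alpha> j *\<^sub>C x l"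
        by (simp add: x_def bounded_operator_simps[OF A] N_def gl scaleC_add_right
            complex_space.scale_right_diff_distrib scaleC_scaleC mult.commute)
      moreover have "cinner (N (f l)) (g (k + l)) = 0"
      proof -
        have "orth_proj k f (f l) = f l" using orth_proj_basis[OF f(1) l] .
        then have "orth_proj k f (N (f l)) = N (f l)"
          using block[of "f l" j] by (simp add: N_def f(2) orth_proj_simps)
        then show ?thesis
          by (metis cinner_orth_proj_swap \<open>orth_proj k f (g (k + l)) = 0\<close> cinner_zero_right)
      qed
      ultimately have "cinner (A j (x l)) (x l)
          = complex_of_real (sqrt (c l)) * complex_of_real (sqrt (c l)) * cinner (N (f l)) (f l)
            + \<alpha> j * cinner (x l) (x l)"
        by (simp add: cinner_add_left cinner_scaleC_left)
          (simp add: x_def gl cinner_add_right cinner_scaleC_right)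
      then show ?thesis
        using l by (simp add: sq c01 orthonormal_familyD[OF x])
    qed
    have trace: "(\<Sum>l<k. cinner (A j (w l)) (w l)) = of_nat k * \<alpha> j + (\<Sum>i<k. cinner (N (f i)) (orth_proj k w (f i)))"
      if "orthonormal_family k w" for w
      using sum_cinner_matrix_plus_scalar[OF f(1) that A scalar'] by (simp add: N_def)
    have "complex_of_real s * (\<Sum>l<k. cinner (A j (y l)) (y l)) +
        complex_of_real t * (\<Sum>l<k. cinner (A j (z l)) (z l))
      = complex_of_real (s + t) * (of_nat k * \<alpha> j) + (\<Sum>i<k. cinner (N (f i)) (D (f i)))"
      by (simp add: trace y z D_def cinner_simps sum.distrib sum_distrib_left algebra_simps)
    also have "\<dots> = of_nat k * \<alpha> j + (\<Sum>i<k. complex_of_real (c i) * cinner (N (f i)) (f i))"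
      by (simp add: st term_D)
    also have "\<dots> = (\<Sum>l<k. cinner (A j (x l)) (x l))"
      by (simp add: Ax sum.distrib)
    finally show ?thesis by simp
  qed
  with x show "\<exists>x. orthonormal_family k x \<and> (\<forall>j. (\<Sum>l<k. cinner (A j (x l)) (x l)) =
      complex_of_real s * (\<Sum>l<k. cinner (A j (y l)) (y l)) +
      complex_of_real t * (\<Sum>l<k. cinner (A j (z l)) (z l)))" by blast
qed

text \<open>For a unit vector \<open>u\<close> in the subspace, \<open>p = \<langle>Pu, u\<rangle>\<close> satisfies \<open>\<parallel>(1 - E)Pu\<parallel>\<^sup>2 \<le> p - p\<^sup>2 \<le> 1/4\<close>,
  since \<open>\<parallel>Pu\<parallel>\<^sup>2 = p\<close> and \<open>\<parallel>EPu\<parallel> \<ge> \<langle>EPu, u\<rangle> = p\<close>.\<close>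

lemma norm_off_diagonal_le:
  assumes e: "orthonormal_family n e" and y: "orthonormal_family k y"
    and u: "orth_proj n e u = u" "norm u = 1"
  shows "norm (orth_proj k y u - orth_proj n e (orth_proj k y u)) \<le> 1 / 2"
proof (rule power2_le_imp_le)
  let ?q = "orth_proj k y u"
  define p where "p = (norm ?q)\<^sup>2"
  have "0 \<le> p" by (simp add: p_def)
  have "0 \<le> p" by (simp add: p_def)
  have "0 \<le> p" by (simp add: p_def)
  have "0 \<le> p" by (simp add: p_def)
  have "cinner (orth_proj n e ?q) u = cinner ?q u"
    by (simp add: cinner_orth_proj_swap u(1))
  also have "\<dots> = complex_of_real p"
    unfolding p_def by (metis cinner_orth_proj_orth_proj[OF y] cinner_self)
  finally have "p = cmod (cinner (orth_proj n e ?q) u)" using \<open>0 \<le> p\<close> by simp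
  also have "\<dots> \<le> norm (orth_proj n e ?q)" using norm_cinner_le[of "orth_proj n e ?q" u] u(2) by simp
  finally have "p\<^sup>2 \<le> (norm (orth_proj n e ?q))\<^sup>2" by (intro power_mono) (simp_all add: p_def)
  then have "(norm (?q - orth_proj n e ?q))\<^sup>2 \<le> p - p\<^sup>2"
    by (simp add: norm_orth_proj_residual[OF e] p_def)
  also have "\<dots> \<le> (1 / 2)\<^sup>2"
    using zero_le_power2[of "p - 1 / 2"] by (simp add: power2_eq_square algebra_simps)
  finally show "(norm (?q - orth_proj n e ?q))\<^sup>2 \<le> (1 / 2)\<^sup>2" .
qed simp

text \<open>The larger solution \<open>c\<close> of \<open>c\<^sup>4 - c\<^sup>2 + r\<^sup>2 = 0\<close>; it stays away from \<open>0\<close> even when \<open>r = 0\<close>.\<close>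

lemma exists_cos_with_product:
  fixes r :: real
  assumes "0 \<le> r" "r \<le> 1 / 2"
  obtains c where "c > 0" "c\<^sup>2 + r\<^sup>2 / c\<^sup>2 = 1"
proof
  \<comment> \<open>Under the root stands the discriminant of the quadratic satisfied by
    \<open>q\<close>, the square of the desired \<open>c\<close>; it is nonnegative because
    \<open>r \<le> 1 / 2\<close>.\<close>
  define d where "d = sqrt (1 - 4 * r\<^sup>2)"
  define q where "q = (1 + d) / 2"
  have "r\<^sup>2 \<le> (1 / 2)\<^sup>2" using assms by (intro power_mono) auto
  then have d: "0 \<le> d" "d\<^sup>2 = 1 - 4 * r\<^sup>2" by (simp_all add: d_def power2_eq_square)
  then have "q > 0" by (simp add: q_def)
  have "q\<^sup>2 + r\<^sup>2 = q"
    using d(2) by (simp add: q_def power2_eq_square field_simps)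
  then have "q + r\<^sup>2 / q = 1"
    using \<open>q > 0\<close> by (simp add: field_simps power2_eq_square)
  then show "(sqrt q)\<^sup>2 + r\<^sup>2 / (sqrt q)\<^sup>2 = 1" "sqrt q > 0" using \<open>q > 0\<close> by simp_all
qed

text \<open>The scalar part contributes a constant and the rest is real linear in the off-diagonal
  block, so a convex combination of points comes from the same combination \<open>G\<close> of
  blocks. The partners of the basis vectors are built from \<open>G (f i)\<close> itself, so the
  complement may have dimension below \<open>k\<close>.\<close>

lemma convex_scalar_plus_off_diagonal:
  fixes A :: "'m::finite \<Rightarrow> 'a::complex_inner \<Rightarrow> 'a"
  assumes e: "orthonormal_family k e"
    and A: "\<And>j x. A j x = a j *\<^sub>C x + M j x"
    and M: "\<And>j. bounded_operator (M j)"
    and M1: "\<And>j u. orth_proj k e u = u \<Longrightarrow> orth_proj k e (M j u) = 0"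
    and M2: "\<And>j v. orth_proj k e v = 0 \<Longrightarrow> orth_proj k e (M j v) = M j v"
  shows "convex (joint_numerical_range k A)"
proof (rule convex_joint_numerical_rangeI)
  fix y z :: "nat \<Rightarrow> 'a" and s t :: real
  assume y: "orthonormal_family k y" and z: "orthonormal_family k z"
    and st: "0 \<le> s" "0 \<le> t" "s + t = 1"
  define H where "H w u = orth_proj k w u - orth_proj k e (orth_proj k w u)" for w u
  define G where "G u = complex_of_real s *\<^sub>C H y u + complex_of_real t *\<^sub>C H z u" for u
  have H: "bounded_operator (H w)" for w
    unfolding H_def
    by (intro bounded_operator_minus bounded_operator_orth_proj
        bounded_operator_compose[OF bounded_operator_orth_proj])
  have G: "bounded_operator G"
    unfolding G_def by (intro bounded_operator_plus bounded_operator_scale H)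
  have E_G: "orth_proj k e (G u) = 0" for u
    by (simp add: G_def H_def orth_proj_simps orth_proj_idem[OF e])
  \<comment> \<open>Diagonalizing the Gram form makes the vectors \<open>G (f i)\<close> pairwise
    orthogonal; some of them may vanish.\<close>
  obtain f where f: "orthonormal_family k f" "orth_proj k f = orth_proj k e"
    and diag: "\<And>i j. i < k \<Longrightarrow> j < k \<Longrightarrow> i \<noteq> j \<Longrightarrow> cinner (G (f i)) (G (f j)) = 0"
  proof (rule hermitian_form_diagonalization[where B = "\<lambda>u v. cinner (G u) (G v)", OF e])
    show "cinner (G u) (G v) = cnj (cinner (G v) (G u))" for u v
      by (rule cinner_commute)
    show "continuous_on UNIV (\<lambda>u. Re (cinner (G u) (G u)))"
      unfolding inner_eq_Re_cinner[symmetric]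
      by (intro continuous_intros linear_continuous_on bounded_operator_bounded_linear G)
  qed (auto simp: bounded_operator_simps[OF G] cinner_simps)
  have E_f: "orth_proj k e (f i) = f i" if "i < k" for i
    using orth_proj_basis[OF f(1) that] by (simp add: f(2))
  have f_perp: "cinner (f i) w = 0" if "i < k" "orth_proj k e w = 0" for i w
    using cinner_orth_proj_swap[of k e "f i" w] that by (simp add: E_f)
  have perp_f: "cinner w (f i) = 0" if "i < k" "orth_proj k e w = 0" for i w
    using f_perp[OF that] by (subst cinner_eq_0_commute)
  \<comment> \<open>The bound \<open>1 / 2\<close> on each of the two blocks passes to their convex
    combination by the triangle inequality, and this is what solving for \<open>c\<close>
    demands.\<close>
  have "\<exists>c. c > 0 \<and> c\<^sup>2 + (norm (G (f i)))\<^sup>2 / c\<^sup>2 = 1" if i: "i < k" for i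
  proof -
    have "norm (H w (f i)) \<le> 1 / 2" if "orthonormal_family k w" for w
      unfolding H_def
      using norm_off_diagonal_le[OF e that E_f[OF i]] orthonormal_family_norm[OF f(1) i] by simp
    then have "s * norm (H y (f i)) + t * norm (H z (f i)) \<le> s * (1 / 2) + t * (1 / 2)"
      using st y z by (intro add_mono mult_left_mono) auto
    also have "\<dots> = 1 / 2" using st(3) by (simp add: field_simps)
    finally have "norm (G (f i)) \<le> 1 / 2"
      using norm_triangle_ineq[of "complex_of_real s *\<^sub>C H y (f i)" "complex_of_real t *\<^sub>C H z (f i)"] st
      by (simp add: G_def norm_scaleC)
    then show ?thesis using exists_cos_with_product[of "norm (G (f i))"] by auto
  qed
  then obtain c where c: "\<And>i. i < k \<Longrightarrow> c i > 0"
    "\<And>i. i < k \<Longrightarrow> (c i)\<^sup>2 + (norm (G (f i)))\<^sup>2 / (c i)\<^sup>2 = 1" by metis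
  \<comment> \<open>The coefficients are inverse to each other, so the cross terms of
    \<open>M\<close> reproduce \<open>G (f i)\<close> without a factor, while the equation for
    \<open>c i\<close> normalizes \<open>x i\<close>.\<close>
  define x where "x i = complex_of_real (c i) *\<^sub>C f i + complex_of_real (inverse (c i)) *\<^sub>C G (f i)" for i
  have x: "orthonormal_family k x"
    unfolding orthonormal_family_def
  proof (intro allI impI)
    fix i j assume ij: "i < k" "j < k"
    have "cinner (x i) (x j) = complex_of_real (c i * c j) * cinner (f i) (f j)
        + complex_of_real (inverse (c i) * inverse (c j)) * cinner (G (f i)) (G (f j))"
      using ij by (simp add: x_def cinner_simps f_perp perp_f E_G del: of_real_inverse)
    also have "\<dots> = (if i = j then 1 else 0)"
    proof (cases "i = j")
      case True
      then have "complex_of_real (c i * c j) * cinner (f i) (f j)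
          + complex_of_real (inverse (c i) * inverse (c j)) * cinner (G (f i)) (G (f j))
        = complex_of_real ((c i)\<^sup>2 + (norm (G (f i)))\<^sup>2 / (c i)\<^sup>2)"
        using ij c(1)[of i]
        by (simp add: orthonormal_family_norm[OF f(1)] cinner_self power2_eq_square field_simps)
      then show ?thesis using True ij by (simp only: c(2)) simp
    next
      case False
      then show ?thesis using ij by (simp add: orthonormal_familyD[OF f(1)] diag)
    qed
    finally show "cinner (x i) (x j) = (if i = j then 1 else 0)" .
  qed
  have "(\<Sum>l<k. cinner (A j (x l)) (x l)) =
      complex_of_real s * (\<Sum>l<k. cinner (A j (y l)) (y l)) +
      complex_of_real t * (\<Sum>l<k. cinner (A j (z l)) (z l))" for j
  proof -
    note M_simps = bounded_operator_simps[OF M]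
    have scalar: "(\<Sum>l<k. cinner (A j (w l)) (w l)) = of_nat k * a j + (\<Sum>l<k. cinner (M j (w l)) (w l))"
      if "orthonormal_family k w" for w
      by (simp add: A cinner_add_left cinner_scaleC_left orthonormal_familyD[OF that] sum.distrib)
    have trace: "(\<Sum>l<k. cinner (M j (w l)) (w l))
        = (\<Sum>i<k. cinner (M j (f i)) (H w (f i)) + cinner (M j (H w (f i))) (f i))" for w
      using sum_cinner_off_diagonal[OF f(1) M, where y = w] M1 M2 by (simp add: f(2) H_def)
    have Mx: "cinner (M j (x l)) (x l) = cinner (M j (f l)) (G (f l)) + cinner (M j (G (f l))) (f l)"
      if l: "l < k" for l
    proof -
      have "cinner (M j (f l)) (f l) = 0"
        by (rule perp_f[OF l M1[OF E_f[OF l]]])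
      moreover have "cinner (M j (G (f l))) (G (f l)) = 0"
        using cinner_orth_proj_swap[of k e "M j (G (f l))" "G (f l)"] M2[OF E_G] E_G by simp
      ultimately show ?thesis
        using c(1)[OF l] by (simp add: x_def M_simps cinner_simps field_simps)
    qed
    have "complex_of_real s * (\<Sum>l<k. cinner (A j (y l)) (y l)) +
        complex_of_real t * (\<Sum>l<k. cinner (A j (z l)) (z l))
      = complex_of_real (s + t) * (of_nat k * a j)
        + (\<Sum>i<k. cinner (M j (f i)) (G (f i)) + cinner (M j (G (f i))) (f i))"
      by (simp add: scalar y z trace G_def M_simps cinner_simps sum.distrib sum_distrib_left
          algebra_simps)
    also have "\<dots> = (\<Sum>l<k. cinner (A j (x l)) (x l))"
      by (simp add: st(3) scalar[OF x] Mx)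
    finally show ?thesis by simp
  qed
  with x show "\<exists>x. orthonormal_family k x \<and> (\<forall>j. (\<Sum>l<k. cinner (A j (x l)) (x l)) =
      complex_of_real s * (\<Sum>l<k. cinner (A j (y l)) (y l)) +
      complex_of_real t * (\<Sum>l<k. cinner (A j (z l)) (z l)))" by blast
qed

section \<open>Operator matrices and unitary equivalence\<close>

text \<open>Setting either component to zero in the block identity isolates one column; the results
  are phrased with \<open>orth_proj\<close>, as the convexity argument needs them.\<close>

lemma matrix_plus_scalarE:
  assumes "T \<in> matrix_plus_scalar k e (complex_space.span (e ` {..<k}))" and e: "orthonormal_family k e"
  obtains \<alpha> where "bounded_operator T" "\<And>u. orth_proj k e u = u \<Longrightarrow> orth_proj k e (T u) = T u"
    "\<And>v. orth_proj k e v = 0 \<Longrightarrow> T v = \<alpha> *\<^sub>C v"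
proof -
  from assms(1) obtain R \<alpha> where T: "bounded_operator T"
    and blocks: "has_blocks (complex_space.span (e ` {..<k})) T (matrix_operator k e R)
      (\<lambda>_. 0) (\<lambda>_. 0) (\<lambda>v. \<alpha> *\<^sub>C v)"
    by (auto simp: matrix_plus_scalar_def)
  then have R: "orth_proj k e u = u \<Longrightarrow> orth_proj k e (matrix_operator k e R u) = matrix_operator k e R u"
    and sum: "orth_proj k e u = u \<Longrightarrow> orth_proj k e v = 0 \<Longrightarrow> T (u + v) = matrix_operator k e R u + \<alpha> *\<^sub>C v"
    for u v
    by (auto simp: has_blocks_def span_orthonormal_iff[OF e] orth_compl_span_iff[OF e] Pi_iff)
  have "matrix_operator k e R 0 = 0" by (simp add: matrix_operator_def)
  then show thesis
    using that[of \<alpha>] T R sum[of _ 0] sum[of 0] by (simp add: orth_proj_simps)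
qed

lemma scalar_plus_off_diagonalE:
  assumes "T \<in> scalar_plus_off_diagonal (complex_space.span (e ` {..<k}))" and e: "orthonormal_family k e"
  obtains a M where "\<And>x. T x = a *\<^sub>C x + M x" "bounded_operator M"
    "\<And>u. orth_proj k e u = u \<Longrightarrow> orth_proj k e (M u) = 0"
    "\<And>v. orth_proj k e v = 0 \<Longrightarrow> orth_proj k e (M v) = M v"
proof -
  from assms(1) obtain a M R1 R2 where T: "bounded_operator T" "T = (\<lambda>x. a *\<^sub>C x + M x)"
    and blocks: "has_blocks (complex_space.span (e ` {..<k})) M (\<lambda>_. 0) R1 R2 (\<lambda>_. 0)"
    unfolding scalar_plus_off_diagonal_def by blast
  \<comment> \<open>Boundedness is given for \<open>T\<close>; \<open>M\<close> inherits it as a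
    difference of bounded operators.\<close>
  have "M = (\<lambda>x. T x - a *\<^sub>C x)" using T(2) by simp
  then have M: "bounded_operator M"
    using T(1) by (simp add: bounded_operator_minus bounded_operator_scale bounded_operator_id)
  from blocks have R1: "orth_proj k e v = 0 \<Longrightarrow> orth_proj k e (R1 v) = R1 v"
    and R2: "orth_proj k e u = u \<Longrightarrow> orth_proj k e (R2 u) = 0"
    and sum: "orth_proj k e u = u \<Longrightarrow> orth_proj k e v = 0 \<Longrightarrow> M (u + v) = R1 v + R2 u"
    for u v
    by (auto simp: has_blocks_def span_orthonormal_iff[OF e] orth_compl_span_iff[OF e] Pi_iff)
  have E0: "orth_proj k e 0 = 0" by (simp add: orth_proj_simps)
  \<comment> \<open>The blocks are arbitrary functions, so their values at zero need an argument:
    they sum to \<open>M 0 = 0\<close>, one lies in the subspace and the other in its complement, so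
    both vanish.\<close>
  have "R1 0 + R2 0 = 0" using sum[OF E0 E0] by (simp add: bounded_operator_zero[OF M])
  moreover from this have "R1 0 = 0"
    using R1[OF E0] R2[OF E0] by (metis orth_proj_simps(1) add.right_neutral E0)
  ultimately have "R1 0 = 0" "R2 0 = 0" by simp_all
  then show thesis
    using that[of a M] T(2) M R1 R2 sum[OF _ E0] sum[OF E0] by simp
qed

text \<open>Composition with \<open>U\<close> and with its adjoint are mutually inverse on
  orthonormal families, and moving the adjoint across the inner product matches the values.\<close>

lemma joint_numerical_range_unitary:
  fixes A :: "'m::finite \<Rightarrow> 'a::complex_hilbert_space \<Rightarrow> 'a"
  assumes "unitary U"
  shows "joint_numerical_range k (\<lambda>j. adj U \<circ> A j \<circ> U) = joint_numerical_range k A"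
proof -
  have U: "cinner (U x) y = cinner x (adj U y)" for x y
    using assms cinner_adj by (auto simp: unitary_def)
  have inv: "adj U (U x) = x" "U (adj U x) = x" for x
    using assms by (auto simp: unitary_def o_def fun_eq_iff)
  have U': "cinner (adj U x) y = cinner x (U y)" for x y
    by (metis U cinner_commute)
  have on: "orthonormal_family k (U \<circ> x)" "orthonormal_family k (adj U \<circ> x)"
    if "orthonormal_family k x" for x
    using that by (simp_all add: orthonormal_family_def U U' inv)
  show ?thesis
    unfolding joint_numerical_range_def
  proof (intro equalityI subsetI; elim CollectE exE conjE)
    fix p x assume "orthonormal_family k x" "p = (\<chi> j. \<Sum>l<k. cinner ((adj U \<circ> A j \<circ> U) (x l)) (x l))"
    then show "p \<in> {(\<chi> j. \<Sum>l<k. cinner (A j (x l)) (x l)) |x. orthonormal_family k x}"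
      using on(1) by (intro CollectI exI[of _ "U \<circ> x"]) (simp add: U')
  next
    fix p x assume "orthonormal_family k x" "p = (\<chi> j. \<Sum>l<k. cinner (A j (x l)) (x l))"
    then show "p \<in> {(\<chi> j. \<Sum>l<k. cinner ((adj U \<circ> A j \<circ> U) (x l)) (x l)) |x. orthonormal_family k x}"
      using on(2) by (intro CollectI exI[of _ "adj U \<circ> x"]) (simp add: U' inv)
  qed
qed

theorem proposition3p2:
  fixes A :: "'m::finite \<Rightarrow> 'a::complex_hilbert_space \<Rightarrow> 'a"
    and k :: nat
    and K :: "'a set"
    and e :: "nat \<Rightarrow> 'a"
    and S :: "('a \<Rightarrow> 'a) set"
  assumes "0 < k"
    and "enat k < hilbert_dim TYPE('a)"
    and "\<And>j. bounded_operator (A j)"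
    and "orthonormal_family k e"
    and "K = complex_space.span (e ` {..<k})"
    and "S = scalar_plus_off_diagonal K \<or>
         enat (2 * k) \<le> hilbert_dim TYPE('a) \<and> S = matrix_plus_scalar k e K"
    and "\<exists>U. unitary U \<and> (\<forall>j. adj U \<circ> A j \<circ> U \<in> S)"
  shows "convex (joint_numerical_range k A)"
proof -
  obtain U where U: "unitary U" "\<And>j. adj U \<circ> A j \<circ> U \<in> S"
    using assms(7) by blast
  let ?B = "\<lambda>j. adj U \<circ> A j \<circ> U"
  have "convex (joint_numerical_range k ?B)"
    using assms(6)
  proof (elim disjE conjE)
    assume "S = scalar_plus_off_diagonal K"
    \<comment> \<open>The scalar and the off-diagonal part are chosen separately for each
      \<open>j\<close>, whereas \<open>e\<close> and \<open>U\<close> are common to all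
      indices.\<close>
    then have "\<exists>a M. (\<forall>x. ?B j x = a *\<^sub>C x + M x) \<and> bounded_operator M \<and>
        (\<forall>u. orth_proj k e u = u \<longrightarrow> orth_proj k e (M u) = 0) \<and>
        (\<forall>v. orth_proj k e v = 0 \<longrightarrow> orth_proj k e (M v) = M v)" for j
      using scalar_plus_off_diagonalE[of "?B j" e k] U(2)[of j] assms(4,5) by metis
    then obtain a M where "\<And>j x. ?B j x = a j *\<^sub>C x + M j x" "\<And>j. bounded_operator (M j)"
      "\<And>j u. orth_proj k e u = u \<Longrightarrow> orth_proj k e (M j u) = 0"
      "\<And>j v. orth_proj k e v = 0 \<Longrightarrow> orth_proj k e (M j v) = M j v" by metis
    then show ?thesis by (rule convex_scalar_plus_off_diagonal[OF assms(4)])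
  next
    assume dim: "enat (2 * k) \<le> hilbert_dim TYPE('a)" and "S = matrix_plus_scalar k e K"
    then have "\<exists>\<alpha>. bounded_operator (?B j) \<and>
        (\<forall>u. orth_proj k e u = u \<longrightarrow> orth_proj k e (?B j u) = ?B j u) \<and>
        (\<forall>v. orth_proj k e v = 0 \<longrightarrow> ?B j v = \<alpha> *\<^sub>C v)" for j
      using matrix_plus_scalarE[of "?B j" k e] U(2)[of j] assms(4,5) by metis
    then obtain \<alpha> where "\<And>j. bounded_operator (?B j)"
      "\<And>j u. orth_proj k e u = u \<Longrightarrow> orth_proj k e (?B j u) = ?B j u"
      "\<And>j v. orth_proj k e v = 0 \<Longrightarrow> ?B j v = \<alpha> j *\<^sub>C v" by metis
    then show ?thesis by (rule convex_matrix_plus_scalar[OF assms(4) dim])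
  qed
  then show ?thesis by (simp only: joint_numerical_range_unitary[OF U(1)])
qed

end
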